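(* Let $G$ be a finite connected vertex-transitive simple graph on $n$ vertices, and let $\lambda_2$ be the smallest nonzero eigenvalue of its Laplacian matrix. Suppose a terminating chip-firing game with $N$ chips was played on $G$ and let $s$ be the total number of firings. Then $$ s \leq \frac{2(n-1)N}{\lambda_2}.$$
   Context: Chip-firing game: a configuration is a vector $\mathbf a\in\mathbb Z_{\ge 0}^n$ ($a_i$ chips on vertex $i$), with $N=\sum_i a_i$ chips. Vertex $i$ of degree $d_i$ may fire if $a_i\ge d_i$; firing moves one chip from $i$ to each neighbour of $i$. A terminating game is a finite sequence of legal firings from an initial configuration ending in a configuration in which no vertex can fire; $s$ is the length of this sequence. The Laplacian $L$ has $L_{ii}=d_i$, $L_{ij}=-1$ for adjacent $i\ne j$, $0$ otherwise; its eigenvalues are $0<\lambda_2\le\dots\le\lambda_n$ for connected $G$. *)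

theory Defs
  imports "HOL-Analysis.Analysis" "Graph_Theory.Graph_Theory"
begin

text \<open>
  Simple graphs are \<^locale>\<open>pair_graph\<close>s (finite, loop-free, symmetric digraphs whose arcs are
  pairs of vertices). In order to use the matrix library, the vertex set is all of a finite type
  \<open>'v\<close>, so that \<open>n = CARD('v)\<close> is arbitrary. Each undirected edge is a pair of opposite arcs; hence
  the degree of a vertex is its \<^const>\<open>out_degree\<close>.
\<close>

definition vertex_transitive :: "'v pair_pre_digraph \<Rightarrow> bool" where
  "vertex_transitive G \<longleftrightarrow>
     (\<forall>u\<in>pverts G. \<forall>v\<in>pverts G. \<exists>f. pre_digraph.digraph_isomorphism (with_proj G) f \<and>
        app_iso f (with_proj G) = with_proj G \<and> iso_verts f u = v)"

abbreviation degree :: "'v pair_pre_digraph \<Rightarrow> 'v \<Rightarrow> nat" where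
  "degree G i \<equiv> out_degree (with_proj G) i"

definition laplacian :: "'v::finite pair_pre_digraph \<Rightarrow> real ^ 'v ^ 'v" where
  "laplacian G = (\<chi> i j. if i = j then real (degree G i) else if (i, j) \<in> parcs G then -1 else 0)"

definition eigenvalue :: "real ^ 'v ^ 'v \<Rightarrow> real \<Rightarrow> bool" where
  "eigenvalue A \<mu> \<longleftrightarrow> (\<exists>x. x \<noteq> 0 \<and> A *v x = \<mu> *s x)"

text \<open>
  For the connected graph on a single vertex there is no nonzero eigenvalue and the following value
  is unspecified; but there the only vertex has degree 0 and can always fire, so no game terminates.
\<close>

definition lambda2 :: "'v::finite pair_pre_digraph \<Rightarrow> real" where
  "lambda2 G = (LEAST \<mu>. eigenvalue (laplacian G) \<mu> \<and> \<mu> \<noteq> 0)"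

definition can_fire :: "'v pair_pre_digraph \<Rightarrow> ('v \<Rightarrow> nat) \<Rightarrow> 'v \<Rightarrow> bool" where
  "can_fire G a i \<longleftrightarrow> i \<in> pverts G \<and> degree G i \<le> a i"

definition fire :: "'v pair_pre_digraph \<Rightarrow> 'v \<Rightarrow> ('v \<Rightarrow> nat) \<Rightarrow> ('v \<Rightarrow> nat)" where
  "fire G i a = (\<lambda>j. if j = i then a i - degree G i else if (i, j) \<in> parcs G then a j + 1 else a j)"

text \<open>\<open>legal_firings G a vs b\<close>: firing the vertices of the list \<open>vs\<close> in order is legal and leads from
  configuration \<open>a\<close> to configuration \<open>b\<close>.\<close>

inductive legal_firings ::
    "'v pair_pre_digraph \<Rightarrow> ('v \<Rightarrow> nat) \<Rightarrow> 'v list \<Rightarrow> ('v \<Rightarrow> nat) \<Rightarrow> bool"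
  for G where
  Nil: "legal_firings G a [] a"
| Cons: "can_fire G a i \<Longrightarrow> legal_firings G (fire G i a) vs b \<Longrightarrow> legal_firings G a (i # vs) b"

definition terminating_game :: "'v pair_pre_digraph \<Rightarrow> ('v \<Rightarrow> nat) \<Rightarrow> 'v list \<Rightarrow> bool" where
  "terminating_game G a vs \<longleftrightarrow> (\<exists>b. legal_firings G a vs b \<and> (\<forall>i\<in>pverts G. \<not> can_fire G b i))"

end

theory Submission
  imports Defs
begin

text \<open>
  Let \<open>x\<close> count the firings of each vertex, so that \<open>L x = a - b\<close> for the initial and final
  configurations. Some vertex \<open>v\<close> never fires, so the centred vector \<open>z = x - (s/n) 1\<close> has
  \<open>z\<^sub>v = -s/n\<close>. Cauchy--Schwarz against the projection of the \<open>v\<close>-th unit vector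
  onto the orthogonal complement of \<open>1\<close> gives \<open>(s/n)\<^sup>2 \<le> (1 - 1/n) |z|\<^sup>2\<close>, the variational characterisation of \<open>\<lambda>\<^sub>2\<close> gives
  \<open>\<lambda>\<^sub>2 |z| \<le> |L z| = |a - b|\<close>, and \<open>|a - b|\<^sup>2 \<le> 2 N\<^sup>2\<close> because \<open>a\<close> and \<open>b\<close> are
  nonnegative with sum \<open>N\<close>.
\<close>

section \<open>Rayleigh quotients of self-adjoint maps\<close>

text \<open>The form attains its minimum on the compact unit sphere of \<open>S\<close>; invariance
  keeps the residual at the minimiser in \<open>S\<close>, so it is an admissible direction of
  variation.\<close>

lemma self_adjoint_least_eigenvector:
  fixes f :: "'a::euclidean_space \<Rightarrow> 'a"
  assumes lin: "linear f" and sa: "\<And>x y. f x \<bullet> y = x \<bullet> f y"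
    and S: "subspace S" and inv: "\<And>x. x \<in> S \<Longrightarrow> f x \<in> S" and ne: "S \<noteq> {0}"
  obtains z \<mu> where "z \<in> S" "z \<noteq> 0" "f z = \<mu> *\<^sub>R z"
    and "\<And>w. w \<in> S \<Longrightarrow> \<mu> * (w \<bullet> w) \<le> w \<bullet> f w"
proof -
  interpret linear f by fact
  obtain y where y: "y \<in> S" "y \<noteq> 0"
    using ne subspace_0[OF S] by blast
  have "(1 / norm y) *\<^sub>R y \<in> S \<inter> sphere 0 1"
    using y S by (simp add: subspace_scale)
  hence "S \<inter> sphere 0 1 \<noteq> {}" by blast
  moreover have "compact (S \<inter> sphere 0 1)"
    by (simp add: S closed_Int_compact closed_subspace)
  moreover have "continuous_on (S \<inter> sphere 0 1) (\<lambda>w. w \<bullet> f w)"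
    by (intro continuous_intros linear_continuous_on) (simp add: lin linear_conv_bounded_linear[symmetric])
  ultimately obtain z where "z \<in> S \<inter> sphere 0 1"
    and "\<forall>w \<in> S \<inter> sphere 0 1. z \<bullet> f z \<le> w \<bullet> f w"
    using continuous_attains_inf[of "S \<inter> sphere 0 1" "\<lambda>w. w \<bullet> f w"] by blast
  hence z: "z \<in> S" "norm z = 1"
    and min: "\<And>w. w \<in> S \<Longrightarrow> norm w = 1 \<Longrightarrow> z \<bullet> f z \<le> w \<bullet> f w" by auto
  define \<mu> where "\<mu> = z \<bullet> f z"
  have bound: "\<mu> * (w \<bullet> w) \<le> w \<bullet> f w" if "w \<in> S" for w
  proof (cases "w = 0")
    case False
    define u where "u = (1 / norm w) *\<^sub>R w"
    have u: "u \<in> S" "norm u = 1" using that False S by (auto simp: u_def subspace_scale)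
    have w: "w = norm w *\<^sub>R u" using False by (simp add: u_def)
    have "\<mu> * (w \<bullet> w) = (norm w)\<^sup>2 * \<mu>"
      by (simp add: power2_norm_eq_inner)
    also have "\<dots> \<le> (norm w)\<^sup>2 * (u \<bullet> f u)"
      unfolding \<mu>_def by (intro mult_left_mono min u) simp
    also have "\<dots> = (norm w *\<^sub>R u) \<bullet> f (norm w *\<^sub>R u)"
      by (simp add: scale power2_eq_square)
    finally show ?thesis using w by simp
  qed (simp add: zero)
  \<comment> \<open>The minimum of the Rayleigh quotient is a critical point: perturb \<open>z\<close> along the residual \<open>r\<close>.\<close>
  define r where "r = f z - \<mu> *\<^sub>R z"
  have rS: "r \<in> S" using z S inv by (simp add: r_def subspace_diff subspace_scale)
  have zz: "z \<bullet> z = 1" using z by (simp add: norm_eq_1)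
  \<comment> \<open>By self-adjointness both cross terms equal
    \<open>r \<bullet> r + \<mu> * (z \<bullet> r)\<close>; their \<open>\<mu>\<close> parts cancel
    against the left side of \<open>le\<close>, leaving \<open>2 * (r \<bullet> r)\<close> as the
    linear coefficient.\<close>
  have quad: "0 \<le> 2 * t * (r \<bullet> r) + t\<^sup>2 * (r \<bullet> f r - \<mu> * (r \<bullet> r))" for t
  proof -
    have le: "\<mu> * ((z + t *\<^sub>R r) \<bullet> (z + t *\<^sub>R r)) \<le> (z + t *\<^sub>R r) \<bullet> f (z + t *\<^sub>R r)"
      using z rS S by (intro bound) (simp add: subspace_add subspace_scale)
    have rfz: "r \<bullet> f z = r \<bullet> r + \<mu> * (z \<bullet> r)"
    proof -
      have "f z = r + \<mu> *\<^sub>R z" by (simp add: r_def)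
      thus ?thesis by (simp add: inner_add_right inner_commute)
    qed
    have zfr: "z \<bullet> f r = r \<bullet> r + \<mu> * (z \<bullet> r)"
      using sa[of z r] rfz by (simp add: inner_commute)
    have sq: "(z + t *\<^sub>R r) \<bullet> (z + t *\<^sub>R r) = 1 + 2 * t * (z \<bullet> r) + t\<^sup>2 * (r \<bullet> r)"
      using zz by (simp add: inner_add_left inner_add_right inner_commute[of r z] power2_eq_square algebra_simps)
    have form: "(z + t *\<^sub>R r) \<bullet> f (z + t *\<^sub>R r)
        = \<mu> + t * (z \<bullet> f r) + t * (r \<bullet> f z) + t\<^sup>2 * (r \<bullet> f r)"
      by (simp add: add scale inner_add_left inner_add_right \<mu>_def power2_eq_square algebra_simps)
    show ?thesis
      using le unfolding sq form rfz zfr by (simp add: algebra_simps)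
  qed
  have "r \<bullet> r = 0"
  proof (rule ccontr)
    assume "r \<bullet> r \<noteq> 0"
    define c where "c = r \<bullet> r"
    have c: "c > 0" using \<open>r \<bullet> r \<noteq> 0\<close> by (simp add: c_def)
    \<comment> \<open>\<open>K\<close> is a positive strict upper bound for the coefficient of
      \<open>t\<^sup>2\<close>; \<open>t = - c / K\<close> minimises
      \<open>2 * t * c + t\<^sup>2 * K\<close>, with negative value
      \<open>- c\<^sup>2 / K\<close>.\<close>
    define K where "K = \<bar>r \<bullet> f r - \<mu> * c\<bar> + 1"
    have K: "K > 0" "r \<bullet> f r - \<mu> * c < K" by (auto simp: K_def)
    have "0 \<le> 2 * (- c / K) * c + (- c / K)\<^sup>2 * (r \<bullet> f r - \<mu> * c)"
      using quad[of "- c / K"] by (simp add: c_def)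
    also have "\<dots> \<le> 2 * (- c / K) * c + (- c / K)\<^sup>2 * K"
      using K by (intro add_left_mono mult_left_mono) auto
    also have "\<dots> = - c\<^sup>2 / K" using K by (simp add: power2_eq_square field_simps)
    finally show False using c K by (simp add: field_simps)
  qed
  hence "f z = \<mu> *\<^sub>R z" by (simp add: r_def)
  thus ?thesis using that[of z \<mu>] z bound by force
qed

section \<open>The Laplacian form and its spectral gap\<close>

locale vertex_type_graph = pair_graph G for G :: "'v::finite pair_pre_digraph" +
  assumes verts_UNIV: "pverts G = UNIV"
begin

lemma real_degree: "real (degree G i) = (\<Sum>j\<in>UNIV. of_bool ((i, j) \<in> parcs G))"
proof -
  have "out_arcs (with_proj G) i = Pair i ` {j. (i, j) \<in> parcs G}"
    by (auto simp: out_arcs_def)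
  hence "degree G i = card {j. (i, j) \<in> parcs G}"
    by (simp add: out_degree_def card_image inj_on_def)
  thus ?thesis by (simp add: Collect_conj_eq)
qed

lemma laplacian_mult_nth:
  "(laplacian G *v x) $ i = (\<Sum>j\<in>UNIV. of_bool ((i, j) \<in> parcs G) * (x $ i - x $ j))"
proof -
  have "(laplacian G *v x) $ i =
    (\<Sum>j\<in>UNIV. (if i = j then real (degree G i) * x $ i else 0) - of_bool ((i, j) \<in> parcs G) * x $ j)"
    unfolding laplacian_def matrix_vector_mult_def
    by (auto intro!: sum.cong dest: no_loops')
  also have "\<dots> = real (degree G i) * x $ i - (\<Sum>j\<in>UNIV. of_bool ((i, j) \<in> parcs G) * x $ j)"
    by (simp add: sum_subtractf)
  also have "\<dots> = (\<Sum>j\<in>UNIV. of_bool ((i, j) \<in> parcs G) * (x $ i - x $ j))"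
    unfolding real_degree by (simp add: right_diff_distrib sum_subtractf sum_distrib_right)
  finally show ?thesis .
qed

lemma arc_sym: "(i, j) \<in> parcs G \<longleftrightarrow> (j, i) \<in> parcs G"
  using arcs_symmetric by blast

text \<open>Exchanging \<open>i\<close> and \<open>j\<close> and adding symmetrises the sum; the
  factor 2 arises because each edge is a pair of opposite arcs. Symmetry, positivity and the kernel
  can all be read off.\<close>

lemma laplacian_form:
  "2 * (y \<bullet> (laplacian G *v x)) =
     (\<Sum>i\<in>UNIV. \<Sum>j\<in>UNIV. of_bool ((i, j) \<in> parcs G) * ((y $ i - y $ j) * (x $ i - x $ j)))"
proof -
  let ?t = "\<lambda>i j. of_bool ((i, j) \<in> parcs G) * (y $ i * (x $ i - x $ j)) :: real"
  have 1: "y \<bullet> (laplacian G *v x) = (\<Sum>i\<in>UNIV. \<Sum>j\<in>UNIV. ?t i j)"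
    by (simp add: inner_vec_def laplacian_mult_nth sum_distrib_left mult.left_commute
        del: sum_of_bool_mult_eq sum_mult_of_bool_eq)
  moreover have "\<dots> = (\<Sum>i\<in>UNIV. \<Sum>j\<in>UNIV. ?t j i)"
    by (rule sum.swap)
  ultimately have "2 * (y \<bullet> (laplacian G *v x)) = (\<Sum>i\<in>UNIV. \<Sum>j\<in>UNIV. ?t i j + ?t j i)"
    by (simp add: sum.distrib)
  also have "\<dots> = (\<Sum>i\<in>UNIV. \<Sum>j\<in>UNIV. of_bool ((i, j) \<in> parcs G) * ((y $ i - y $ j) * (x $ i - x $ j)))"
    by (intro sum.cong refl) (simp add: arc_sym algebra_simps)
  finally show ?thesis .
qed

lemma laplacian_self_adjoint: "(laplacian G *v x) \<bullet> y = x \<bullet> (laplacian G *v y)"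
proof -
  have "2 * (y \<bullet> (laplacian G *v x)) = 2 * (x \<bullet> (laplacian G *v y))"
    unfolding laplacian_form by (simp add: mult_ac)
  thus ?thesis by (simp add: inner_commute)
qed

lemma laplacian_psd: "0 \<le> x \<bullet> (laplacian G *v x)"
proof -
  have "0 \<le> 2 * (x \<bullet> (laplacian G *v x))"
    unfolding laplacian_form by (intro sum_nonneg) simp
  thus ?thesis by simp
qed

lemma laplacian_one: "laplacian G *v 1 = 0"
  by (simp add: vec_eq_iff laplacian_mult_nth)

lemma laplacian_perp_one: "(laplacian G *v x) \<bullet> 1 = 0"
  by (simp add: laplacian_self_adjoint laplacian_one)

text \<open>A vanishing sum of squares makes \<open>x\<close> agree across every arc, and paths
  propagate this.\<close>

lemma laplacian_form_zero_imp_const: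
  assumes conn: "Digraph_Component.connected (with_proj G)"
    and zero: "x \<bullet> (laplacian G *v x) = 0"
  shows "x $ u = x $ v"
proof -
  have "(\<Sum>i\<in>UNIV. \<Sum>j\<in>UNIV. of_bool ((i, j) \<in> parcs G) * ((x $ i - x $ j) * (x $ i - x $ j))) = 0"
    using zero laplacian_form[of x x] by simp
  hence "of_bool ((i, j) \<in> parcs G) * ((x $ i - x $ j) * (x $ i - x $ j)) = 0" for i j
    by (subst (asm) sum_nonneg_eq_0_iff; simp add: sum_nonneg)
       (subst (asm) sum_nonneg_eq_0_iff; simp)
  hence arc: "x $ i = x $ j" if "(i, j) \<in> parcs G" for i j
    using that by (metis mult_eq_0_iff of_bool_eq_0_iff eq_iff_diff_eq_0)
  \<comment> \<open>\<open>connected\<close> refers to the symmetric closure, which has the same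
    reachability because the arcs of \<open>G\<close> are already symmetric.\<close>
  have "u \<rightarrow>\<^sup>*\<^bsub>with_proj G\<^esub> v"
    using conn verts_UNIV reachable_mk_symmetric_eq[OF pair_sym_arcs]
    by (auto simp: connected_def strongly_connected_def)
  thus ?thesis
    by (induct rule: converse_reachable_induct) (auto dest: arc)
qed

text \<open>On the complement \<open>S\<close> of the constants the least Rayleigh quotient is an
  eigenvalue. It is positive, since a zero form would make its eigenvector constant, hence 0 in
  \<open>S\<close>. Two vertices are what makes \<open>S\<close> nontrivial.\<close>

lemma
  assumes conn: "Digraph_Component.connected (with_proj G)" and n: "CARD('v) \<ge> 2"
  shows lambda2_pos: "0 < lambda2 G"
    and lambda2_le_form: "z \<bullet> 1 = 0 \<Longrightarrow> lambda2 G * (z \<bullet> z) \<le> z \<bullet> (laplacian G *v z)"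
proof -
  define S where "S = {z :: real ^ 'v. z \<bullet> 1 = 0}"
  have "subspace S"
    by (simp add: S_def subspace_hyperplane2 inner_commute)
  moreover have "S \<noteq> {0}"
  proof -
    obtain u v :: 'v where "u \<noteq> v"
      using n by (metis UNIV_I card_2_iff' card_le_Suc0_iff_eq finite not_less_eq_eq numeral_2_eq_2)
    hence "axis u 1 - axis v 1 \<in> S" "axis u 1 - axis v 1 \<noteq> (0 :: real ^ 'v)"
      by (auto simp: S_def inner_diff_left inner_axis' axis_eq_axis)
    thus ?thesis by blast
  qed
  moreover have "linear ((*v) (laplacian G))" by simp
  moreover have "laplacian G *v x \<in> S" for x
    by (simp add: S_def laplacian_perp_one)
  ultimately obtain z \<mu> where z: "z \<in> S" "z \<noteq> 0" "laplacian G *v z = \<mu> *\<^sub>R z"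
    and bound: "\<And>w. w \<in> S \<Longrightarrow> \<mu> * (w \<bullet> w) \<le> w \<bullet> (laplacian G *v w)"
    using self_adjoint_least_eigenvector[of "(*v) (laplacian G)" S] laplacian_self_adjoint by blast
  have "\<mu> * (z \<bullet> z) = z \<bullet> (laplacian G *v z)" using z by simp
  moreover have "z \<bullet> (laplacian G *v z) \<noteq> 0"
  proof
    assume "z \<bullet> (laplacian G *v z) = 0"
    then obtain c where c: "\<And>i. z $ i = c"
      using laplacian_form_zero_imp_const[OF conn] by metis
    with z(1) have "real CARD('v) * c = 0" by (simp add: S_def inner_vec_def)
    with c z(2) show False by (simp add: vec_eq_iff)
  qed
  ultimately have "\<mu> * (z \<bullet> z) > 0"
    using laplacian_psd[of z] by linarith
  hence pos: "\<mu> > 0"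
    using inner_ge_zero[of z] by (auto simp: zero_less_mult_iff)
  have "lambda2 G = \<mu>"
    unfolding lambda2_def
  proof (rule Least_equality)
    show "eigenvalue (laplacian G) \<mu> \<and> \<mu> \<noteq> 0"
      using z pos by (auto simp: eigenvalue_def scalar_mult_eq_scaleR)
  next
    fix \<nu> assume "eigenvalue (laplacian G) \<nu> \<and> \<nu> \<noteq> 0"
    then obtain w where w: "w \<noteq> 0" "laplacian G *v w = \<nu> *\<^sub>R w" "\<nu> \<noteq> 0"
      by (auto simp: eigenvalue_def scalar_mult_eq_scaleR)
    \<comment> \<open>An eigenvector with nonzero eigenvalue lies in the image of the Laplacian,
      hence in \<open>S\<close>, so \<open>\<mu>\<close> competes with all nonzero
      eigenvalues.\<close>
    have "w \<in> S" using laplacian_perp_one[of w] w by (simp add: S_def)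
    from bound[OF this] w show "\<mu> \<le> \<nu>" by simp
  qed
  with pos bound show "0 < lambda2 G"
    "z \<bullet> 1 = 0 \<Longrightarrow> lambda2 G * (z \<bullet> z) \<le> z \<bullet> (laplacian G *v z)" for z
    by (auto simp: S_def)
qed

section \<open>Chip firing in terms of the Laplacian\<close>

text \<open>Legality makes the truncated subtraction in \<open>fire\<close> exact; arc symmetry lets
  a column of the Laplacian describe the outgoing chips.\<close>

lemma fire_laplacian:
  assumes "can_fire G a i"
  shows "(\<chi> j. real (fire G i a j)) = (\<chi> j. real (a j)) - laplacian G *v axis i 1"
proof -
  have "real (fire G i a j) = real (a j) - laplacian G $ j $ i" for j
    using assms arc_sym[of i j] by (auto simp: fire_def can_fire_def laplacian_def dest: no_loops')
  thus ?thesis by (simp add: vec_eq_iff matrix_vector_mul_component column_def matrix_vector_mult_basis)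
qed

lemma legal_firings_laplacian:
  assumes "legal_firings G a vs b"
  shows "laplacian G *v (\<chi> i. real (count_list vs i)) = (\<chi> i. real (a i)) - (\<chi> i. real (b i))"
  using assms
proof induct
  case (Nil a)
  thus ?case by (simp add: zero_vec_def[symmetric])
next
  case (Cons a i vs b)
  have "(\<chi> j. real (count_list (i # vs) j)) = axis i 1 + (\<chi> j. real (count_list vs j))"
    by (simp add: vec_eq_iff axis_def)
  thus ?case using Cons fire_laplacian[of a i] by (simp add: matrix_vector_right_distrib)
qed

lemma legal_firings_append:
  "legal_firings G a (us @ ws) b \<longleftrightarrow> (\<exists>c. legal_firings G a us c \<and> legal_firings G c ws b)"
proof (induct us arbitrary: a)
  case Nil
  show ?case by (auto intro: legal_firings.Nil elim: legal_firings.cases)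
next
  case (Cons u us)
  have *: "legal_firings G a (u # xs) c \<longleftrightarrow> can_fire G a u \<and> legal_firings G (fire G u a) xs c" for a xs c
    by (auto intro: legal_firings.Cons elim: legal_firings.cases)
  show ?case using Cons by (auto simp: *)
qed

text \<open>If every vertex fires, take the one whose last firing comes first: each of its neighbours
  fires afterwards and sends it a chip, so that it can fire again.\<close>

lemma terminating_game_unfired:
  assumes "terminating_game G a vs"
  obtains v where "v \<notin> set vs"
proof (rule ccontr)
  assume "\<not> thesis"
  hence all: "set vs = UNIV" using that by blast
  obtain b where b: "legal_firings G a vs b" "\<And>i. \<not> can_fire G b i"
    using assms verts_UNIV by (auto simp: terminating_game_def)
  \<comment> \<open>\<open>v # ws\<close> is the shortest suffix that still contains every vertex:
    the induction drops heads while the tail covers everything.\<close>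
  have "\<exists>us v ws. vs = us @ v # ws \<and> v \<notin> set ws \<and> insert v (set ws) = UNIV"
    using all
  proof (induct vs)
    case (Cons v vs)
    show ?case
    proof (cases "set vs = UNIV")
      case True
      thus ?thesis using Cons by (metis append_Cons)
    next
      case False
      thus ?thesis using Cons.prems by (metis append_Nil insert_absorb list.simps(15))
    qed
  qed simp
  then obtain us v ws where vs: "vs = us @ v # ws" "v \<notin> set ws" "insert v (set ws) = UNIV"
    by blast
  then obtain c where ws: "legal_firings G c ws b"
    using b(1) by (metis legal_firings_append append_Cons append_Nil append_assoc)
  have "real (degree G v) \<le> (\<Sum>j\<in>UNIV. of_bool ((v, j) \<in> parcs G) * real (count_list ws j))"
    unfolding real_degree
  proof (rule sum_mono)
    fix j
    have "count_list ws j \<ge> 1" if "(v, j) \<in> parcs G"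
      using that vs(3) no_loops'[OF that] count_list_0_iff[of ws j] by (metis UNIV_I insertE less_one not_le)
    thus "of_bool ((v, j) \<in> parcs G) \<le> of_bool ((v, j) \<in> parcs G) * real (count_list ws j)"
      by (cases "(v, j) \<in> parcs G") auto
  qed
  \<comment> \<open>\<open>v\<close> does not fire during \<open>ws\<close>, so its own count is 0
    and only chips received from neighbours remain.\<close>
  also have "\<dots> = - (laplacian G *v (\<chi> i. real (count_list ws i))) $ v"
    using vs(2) by (simp add: laplacian_mult_nth sum_negf)
  also have "\<dots> = real (b v) - real (c v)"
    by (simp add: legal_firings_laplacian[OF ws])
  finally have "degree G v \<le> b v" by linarith
  thus False using b(2)[of v] by (simp add: can_fire_def verts_UNIV)
qed

end

section \<open>Norm estimates\<close>

text \<open>Each entry is at most the total; for infinite \<open>A\<close> both sums are 0 by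
  convention.\<close>

lemma sum_squares_le_square_sum:
  fixes f :: "'a \<Rightarrow> real"
  assumes "\<And>i. i \<in> A \<Longrightarrow> 0 \<le> f i"
  shows "(\<Sum>i\<in>A. f i * f i) \<le> (\<Sum>i\<in>A. f i)\<^sup>2"
proof (cases "finite A")
  case True
  have "(\<Sum>i\<in>A. f i * f i) \<le> (\<Sum>i\<in>A. f i * sum f A)"
    using assms True by (intro sum_mono mult_left_mono member_le_sum) auto
  thus ?thesis by (simp add: sum_distrib_right power2_eq_square)
qed simp

lemma coordinate_square_le:
  fixes z :: "real ^ 'v::finite"
  assumes "z \<bullet> 1 = 0"
  shows "(z $ v)\<^sup>2 \<le> (1 - 1 / CARD('v)) * (z \<bullet> z)"
proof -
  \<comment> \<open>The projected unit vector pairs with \<open>z\<close> just as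
    \<open>axis v 1\<close> does, but its squared norm is smaller by \<open>1 / n\<close>.\<close>
  let ?p = "axis v 1 - (1 / CARD('v)) *\<^sub>R 1 :: real ^ 'v"
  have "?p \<bullet> ?p = 1 - 1 / CARD('v)"
    by (simp add: inner_diff_left inner_diff_right inner_axis inner_axis' inner_vec_def[of 1 1])
  moreover have "?p \<bullet> z = z $ v"
    using assms by (simp add: inner_diff_left inner_axis' inner_commute[of 1 z])
  ultimately show ?thesis using Cauchy_Schwarz_ineq[of ?p z] by simp
qed

section \<open>Combination of the estimates for the firing vector\<close>

theorem mainTheorem4:
  fixes G :: "'v::finite pair_pre_digraph"
    and a :: "'v \<Rightarrow> nat"
    and vs :: "'v list"
    and n N s :: nat
  assumes "pair_graph G"
    and "pverts G = UNIV"
    and "Digraph_Component.connected (with_proj G)"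
    and "vertex_transitive G"
    and "n = card (pverts G)"
    and "terminating_game G a vs"
    and "N = (\<Sum>i\<in>pverts G. a i)"
    and "s = length vs"
  shows "real s \<le> 2 * (real n - 1) * real N / lambda2 G"
proof -
  interpret vertex_type_graph G
    using assms(1,2) by (simp add: vertex_type_graph_def vertex_type_graph_axioms_def)
  have n: "n = CARD('v)" using assms by simp
  obtain v where v: "v \<notin> set vs" using terminating_game_unfired[OF assms(6)] .
  show ?thesis
  proof (cases "n \<ge> 2")
    \<comment> \<open>The only vertex is the unfired \<open>v\<close>, so \<open>s = 0\<close>; the
      factor \<open>n - 1 = 0\<close> makes the right side 0 whatever \<open>lambda2 G\<close>
      is.\<close>
    case False
    hence "card (UNIV :: 'v set) \<le> Suc 0" using n by simp
    hence eq: "u = v" for u by (simp add: card_le_Suc0_iff_eq)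
    have "set vs = {}" using v eq by (metis all_not_in_conv)
    moreover have "UNIV = {v}" using eq by auto
    hence "n = 1" unfolding n by (metis is_singletonI is_singleton_altdef)
    ultimately show ?thesis using assms(8) by simp
  next
    case True
    note pos = lambda2_pos[OF assms(3) True[unfolded n]]
    obtain b where b: "legal_firings G a vs b"
      using assms(6) by (auto simp: terminating_game_def)
    define x where "x = (\<chi> i. real (count_list vs i))"
    define A where "A = (\<chi> i. real (a i))"
    define B where "B = (\<chi> i. real (b i))"
    have Lx: "laplacian G *v x = A - B"
      unfolding x_def A_def B_def by (rule legal_firings_laplacian[OF b])
    have x1: "x \<bullet> 1 = real s"
      using sum_count_set[of vs UNIV] by (simp add: x_def inner_vec_def assms(8) flip: of_nat_sum)
    have A1: "A \<bullet> 1 = real N" by (simp add: A_def inner_vec_def assms(2,7))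
    \<comment> \<open>Conservation of chips: images of the Laplacian are orthogonal to 1.\<close>
    have B1: "B \<bullet> 1 = real N"
      using laplacian_perp_one[of x] A1 by (simp add: Lx inner_diff_left)
    define z where "z = x - (real s / n) *\<^sub>R 1"
    have z1: "z \<bullet> 1 = 0"
      using x1 True by (simp add: z_def inner_diff_left inner_vec_def[of 1 1] n)
    have Lz: "laplacian G *v z = A - B"
      by (simp add: z_def Lx laplacian_one matrix_vector_mult_diff_distrib matrix_vector_mult_scaleR)
    have zv: "z $ v = - real s / n"
      using v by (simp add: z_def x_def count_list_0_iff)
    have AA: "A \<bullet> A \<le> (real N)\<^sup>2"
      using sum_squares_le_square_sum[of UNIV "\<lambda>i. real (a i)"] A1 by (simp add: A_def inner_vec_def)
    have BB: "B \<bullet> B \<le> (real N)\<^sup>2"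
      using sum_squares_le_square_sum[of UNIV "\<lambda>i. real (b i)"] B1 by (simp add: B_def inner_vec_def)
    \<comment> \<open>Dropping the nonnegative cross term gives \<open>2 * N\<^sup>2\<close>, where
      the triangle inequality would give \<open>4 * N\<^sup>2\<close>.\<close>
    have "A \<bullet> B \<ge> 0" by (simp add: A_def B_def inner_vec_def sum_nonneg)
    with AA BB have diff: "(A - B) \<bullet> (A - B) \<le> 2 * (real N)\<^sup>2"
      by (simp add: inner_diff_left inner_diff_right inner_commute)
    have "lambda2 G * norm z \<le> norm (A - B)"
    proof (cases "z = 0")
      case False
      have "lambda2 G * norm z * norm z \<le> z \<bullet> (A - B)"
        using lambda2_le_form[OF assms(3) True[unfolded n] z1]
        by (simp add: Lz power2_norm_eq_inner[symmetric] power2_eq_square mult.assoc)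
      also have "\<dots> \<le> norm (A - B) * norm z"
        using norm_cauchy_schwarz[of z "A - B"] by (simp add: mult.commute)
      finally show ?thesis using False by simp
    qed simp
    hence "(lambda2 G * norm z)\<^sup>2 \<le> (norm (A - B))\<^sup>2"
      using pos by (intro power_mono) auto
    hence zz: "(lambda2 G)\<^sup>2 * (z \<bullet> z) \<le> 2 * (real N)\<^sup>2"
      using diff by (simp add: power_mult_distrib power2_norm_eq_inner)
    have "(lambda2 G * real s)\<^sup>2 = n\<^sup>2 * ((lambda2 G)\<^sup>2 * (z $ v)\<^sup>2)"
      using True by (simp add: zv power2_eq_square)
    also have "\<dots> \<le> n\<^sup>2 * ((lambda2 G)\<^sup>2 * ((1 - 1 / n) * (z \<bullet> z)))"
      using coordinate_square_le[OF z1, of v] by (intro mult_left_mono) (auto simp: n)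
    also have "\<dots> = n * (real n - 1) * ((lambda2 G)\<^sup>2 * (z \<bullet> z))"
      using True by (simp add: field_simps power2_eq_square)
    also have "\<dots> \<le> n * (real n - 1) * (2 * (real N)\<^sup>2)"
      using zz True by (intro mult_left_mono) auto
    \<comment> \<open>This is \<open>n \<le> 2 * (n - 1)\<close>, valid from \<open>n = 2\<close>
      on. With \<open>n\<^sup>2\<close> in place of \<open>n * (n - 1)\<close> the comparison with
      the target would fail for \<open>n = 2\<close> and \<open>n = 3\<close> when
      \<open>N > 0\<close>.\<close>
    also have "\<dots> \<le> (2 * (real n - 1)) * (real n - 1) * (2 * (real N)\<^sup>2)"
      using True by (intro mult_right_mono) auto
    also have "\<dots> = (2 * (real n - 1) * real N)\<^sup>2"
      by (simp add: power2_eq_square algebra_simps)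
    finally have "lambda2 G * real s \<le> 2 * (real n - 1) * real N"
      using True by (intro power2_le_imp_le[of "lambda2 G * real s"]) auto
    thus ?thesis using pos by (simp add: pos_le_divide_eq mult.commute)
  qed
qed

end
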